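(* For the Basilica group, the set $\kappa$ of singular points is empty.
   Context: The Basilica group $G$ is the group of automorphisms of the rooted binary tree $\{0,1\}^*$ generated by $a$ and $b$ defined recursively, for $w\in\{0,1\}^*$, by $a\circ(0w)=0\,(b\circ w)$, $a\circ(1w)=1w$, $b\circ(0w)=1\,(a\circ w)$, $b\circ(1w)=0w$. It acts on the boundary $\{0,1\}^\omega$ (right-infinite words, with the product topology). A point $\xi\in\{0,1\}^\omega$ is singular if the map $\xi\mapsto\mathrm{Stab}(\xi)=\{g\in G:g\circ\xi=\xi\}$ from $\{0,1\}^\omega$ to the space $Sub(G)$ of subgroups of $G$ (with the topology induced from the product topology of $\{0,1\}^{G}$, identifying a subgroup with its characteristic function) is not continuous at $\xi$. The set of singular points is $\kappa$. *)

theory Defs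
  imports "HOL-Analysis.Analysis" "HOL-Algebra.Generated_Groups"
begin

section \<open>The rooted binary tree and its automorphism group\<close>

text \<open>The letters 0 and 1 are rendered as False and True; the vertices of the tree are the
  finite words, of type bool list, and its boundary consists of the infinite words, of type
  nat \<Rightarrow> bool.\<close>

definition tree_edge :: "bool list \<Rightarrow> bool list \<Rightarrow> bool" where
  "tree_edge u v \<longleftrightarrow> (\<exists>x. v = u @ [x])"

definition tree_automorphism :: "(bool list \<Rightarrow> bool list) \<Rightarrow> bool" where
  "tree_automorphism g \<longleftrightarrow>
     bij g \<and> g [] = [] \<and> (\<forall>u v. tree_edge (g u) (g v) \<longleftrightarrow> tree_edge u v)"

definition Aut_tree :: "(bool list \<Rightarrow> bool list) monoid" where
  "Aut_tree = \<lparr>carrier = {g. tree_automorphism g}, mult = (\<circ>), one = id\<rparr>"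

lemma tree_automorphismI:
  assumes "bij g" "g [] = []" "\<And>u x. \<exists>y. g (u @ [x]) = g u @ [y]"
  shows "tree_automorphism g"
proof -
  have "tree_edge u v" if e: "tree_edge (g u) (g v)" for u v
  proof (cases v rule: rev_cases)
    case Nil
    then show ?thesis using e assms(2) by (auto simp: tree_edge_def)
  next
    case (snoc v' x)
    then have "g u = g v'"
      using e assms(3)[of v' x] by (auto simp: tree_edge_def)
    then show ?thesis
      using assms(1) snoc by (auto simp: tree_edge_def bij_def inj_eq)
  qed
  moreover have "tree_edge (g u) (g v)" if "tree_edge u v" for u v
    using that assms(3) by (auto simp: tree_edge_def)
  ultimately show ?thesis
    unfolding tree_automorphism_def using assms(1,2) by blast
qed

lemma tree_automorphism_snoc:
  assumes "tree_automorphism g"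
  shows "\<exists>y. g (u @ [x]) = g u @ [y]"
  using assms by (auto simp: tree_automorphism_def tree_edge_def)

lemma tree_automorphism_length:
  assumes "tree_automorphism g"
  shows "length (g w) = length w"
proof (induction w rule: rev_induct)
  case Nil
  then show ?case using assms by (simp add: tree_automorphism_def)
next
  case (snoc x w)
  then show ?case using tree_automorphism_snoc[OF assms, of w x] by auto
qed

lemma tree_automorphism_take:
  assumes "tree_automorphism g"
  shows "take n (g w) = g (take n w)"
proof (induction w rule: rev_induct)
  case Nil
  then show ?case using assms by (simp add: tree_automorphism_def)
next
  case (snoc x w)
  then show ?case
    using tree_automorphism_snoc[OF assms, of w x] tree_automorphism_length[OF assms, of w]
    by (cases "n \<le> length w") auto
qed

lemma group_Aut_tree: "group Aut_tree"
proof (rule groupI)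
  fix g assume "g \<in> carrier Aut_tree"
  then have g: "tree_automorphism g" by (simp add: Aut_tree_def)
  then have b: "bij g" by (simp add: tree_automorphism_def)
  have r: "g (inv_into UNIV g w) = w" and l: "inv_into UNIV g (g w) = w" for w
    using b by (auto simp: bij_def surj_f_inv_f inv_f_f)
  have "tree_edge (inv_into UNIV g u) (inv_into UNIV g v) \<longleftrightarrow> tree_edge u v" for u v
    using g r unfolding tree_automorphism_def by metis
  moreover have "inv_into UNIV g [] = []"
    using g l unfolding tree_automorphism_def by metis
  ultimately have "tree_automorphism (inv_into UNIV g)"
    using b by (simp add: tree_automorphism_def bij_imp_bij_inv)
  moreover have "inv_into UNIV g \<circ> g = id" using l by (simp add: fun_eq_iff)
  ultimately show "\<exists>h\<in>carrier Aut_tree. h \<otimes>\<^bsub>Aut_tree\<^esub> g = \<one>\<^bsub>Aut_tree\<^esub>"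
    by (auto simp: Aut_tree_def)
qed (auto simp: Aut_tree_def tree_automorphism_def bij_comp comp_assoc)

section \<open>The Basilica group\<close>

fun basilica_a :: "bool list \<Rightarrow> bool list" and basilica_b :: "bool list \<Rightarrow> bool list" where
  "basilica_a [] = []"
| "basilica_a (False # w) = False # basilica_b w"
| "basilica_a (True # w) = True # w"
| "basilica_b [] = []"
| "basilica_b (False # w) = True # basilica_a w"
| "basilica_b (True # w) = False # w"

definition Basilica :: "(bool list \<Rightarrow> bool list) monoid" where
  "Basilica = subgroup_generated Aut_tree {basilica_a, basilica_b}"

lemma basilica_generators_in_Aut_tree:
  "basilica_a \<in> carrier Aut_tree" "basilica_b \<in> carrier Aut_tree"
proof -
  have inj: "(basilica_a u = basilica_a v \<longrightarrow> u = v) \<and> (basilica_b u = basilica_b v \<longrightarrow> u = v)" for u v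
  proof (induction u arbitrary: v)
    case Nil
    show ?case by (cases v; cases "hd v") auto
  next
    case (Cons x u)
    then show ?case by (cases v; cases "hd v"; cases x) auto
  qed
  have surj: "(\<exists>w. basilica_a w = v) \<and> (\<exists>w. basilica_b w = v)" for v
  proof (induction v)
    case Nil
    have "basilica_a [] = []" "basilica_b [] = []" by simp_all
    then show ?case by blast
  next
    case (Cons x v)
    then obtain p q where "basilica_a p = v" "basilica_b q = v" by blast
    then have eqs: "basilica_a (False # q) = False # v" "basilica_a (True # v) = True # v"
      "basilica_b (False # p) = True # v" "basilica_b (True # v) = False # v" by simp_all
    have "x = True \<or> x = False" by blast
    then show ?case using eqs by (elim disjE) (hypsubst, blast)+
  qed
  have snoc: "(\<exists>y. basilica_a (u @ [x]) = basilica_a u @ [y]) \<and>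
              (\<exists>y. basilica_b (u @ [x]) = basilica_b u @ [y])" for u x
  proof (induction u)
    case Nil
    show ?case by (cases x) auto
  next
    case (Cons z u)
    then show ?case by (cases z) auto
  qed
  have "bij basilica_a" "bij basilica_b"
  proof -
    show "bij basilica_a"
    proof (intro bijI injI)
      show "u = v" if "basilica_a u = basilica_a v" for u v
        using inj[of u v] that by blast
      have "v \<in> range basilica_a" for v
        using surj[of v] by (metis rangeI)
      then show "range basilica_a = UNIV" by blast
    qed
    show "bij basilica_b"
    proof (intro bijI injI)
      show "u = v" if "basilica_b u = basilica_b v" for u v
        using inj[of u v] that by blast
      have "v \<in> range basilica_b" for v
        using surj[of v] by (metis rangeI)
      then show "range basilica_b = UNIV" by blast
    qed
  qed
  note bij = this
  have "tree_automorphism basilica_a"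
    by (rule tree_automorphismI[OF bij(1) basilica_a.simps(1) conjunct1[OF snoc]])
  moreover have "tree_automorphism basilica_b"
    by (rule tree_automorphismI[OF bij(2) basilica_b.simps(1) conjunct2[OF snoc]])
  ultimately show "basilica_a \<in> carrier Aut_tree" "basilica_b \<in> carrier Aut_tree"
    by (simp_all add: Aut_tree_def)
qed

lemma group_Basilica: "group Basilica"
  unfolding Basilica_def by (rule group.group_subgroup_generated[OF group_Aut_tree])

lemma carrier_Basilica: "carrier Basilica = generate Aut_tree {basilica_a, basilica_b}"
  using basilica_generators_in_Aut_tree
  by (simp add: Basilica_def carrier_subgroup_generated)

section \<open>The action on the boundary\<close>

text \<open>An automorphism preserves prefixes and lengths, so its action extends to the boundary: the
  length-\<open>n\<close> prefix of the image of \<open>\<xi>\<close> is the image of the length-\<open>n\<close> prefix of \<open>\<xi>\<close>.\<close>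

definition prefix_of :: "nat \<Rightarrow> (nat \<Rightarrow> bool) \<Rightarrow> bool list" where
  "prefix_of n \<xi> = map \<xi> [0..<n]"

definition boundary_act :: "(bool list \<Rightarrow> bool list) \<Rightarrow> (nat \<Rightarrow> bool) \<Rightarrow> (nat \<Rightarrow> bool)" where
  "boundary_act g \<xi> = (\<lambda>n. g (prefix_of (Suc n) \<xi>) ! n)"

lemma prefix_of_boundary_act:
  assumes "tree_automorphism g"
  shows "prefix_of n (boundary_act g \<xi>) = g (prefix_of n \<xi>)"
proof (rule nth_equalityI)
  show len: "length (prefix_of n (boundary_act g \<xi>)) = length (g (prefix_of n \<xi>))"
    using tree_automorphism_length[OF assms] by (simp add: prefix_of_def)
  fix i assume "i < length (prefix_of n (boundary_act g \<xi>))"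
  then have i: "i < n" by (simp add: prefix_of_def)
  have "take (Suc i) (prefix_of n \<xi>) = prefix_of (Suc i) \<xi>"
    using i by (simp add: prefix_of_def take_map del: upt_Suc)
  then have "take (Suc i) (g (prefix_of n \<xi>)) = g (prefix_of (Suc i) \<xi>)"
    by (simp only: tree_automorphism_take[OF assms])
  then have "take (Suc i) (g (prefix_of n \<xi>)) ! i = boundary_act g \<xi> i"
    by (simp only: boundary_act_def)
  then have "g (prefix_of n \<xi>) ! i = boundary_act g \<xi> i"
    by (simp only: nth_take[OF lessI])
  then show "prefix_of n (boundary_act g \<xi>) ! i = g (prefix_of n \<xi>) ! i"
    using i unfolding prefix_of_def by simp
qed

lemma prefix_of_eqI:
  assumes "\<And>n. prefix_of n \<xi> = prefix_of n \<eta>"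
  shows "\<xi> = \<eta>"
proof
  fix n
  show "\<xi> n = \<eta> n" using assms[of "Suc n"] by (simp add: prefix_of_def)
qed

lemma boundary_act_id: "boundary_act id \<xi> = \<xi>"
  by (auto simp: boundary_act_def prefix_of_def fun_eq_iff nth_append)

lemma boundary_act_comp:
  assumes "tree_automorphism g" "tree_automorphism h"
  shows "boundary_act (g \<circ> h) \<xi> = boundary_act g (boundary_act h \<xi>)"
proof -
  have "prefix_of (Suc n) (boundary_act h \<xi>) = h (prefix_of (Suc n) \<xi>)" for n
    by (rule prefix_of_boundary_act[OF assms(2)])
  then show ?thesis by (simp add: boundary_act_def[of "g \<circ> h"] boundary_act_def[of g])
qed

definition boundary_topology :: "(nat \<Rightarrow> bool) topology" where
  "boundary_topology = product_topology (\<lambda>_. discrete_topology UNIV) UNIV"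

section \<open>The space of subgroups and singular points\<close>

text \<open>The product topology on \<open>{0,1}\<^sup>G\<close> lives on functions that are extensional on the carrier
  of \<open>G\<close>, hence the restriction in the characteristic function of a subgroup.\<close>

definition char_fun :: "('g, 'm) monoid_scheme \<Rightarrow> 'g set \<Rightarrow> ('g \<Rightarrow> bool)" where
  "char_fun G H = (\<lambda>g\<in>carrier G. g \<in> H)"

definition Sub_topology :: "('g, 'm) monoid_scheme \<Rightarrow> 'g set topology" where
  "Sub_topology G =
     pullback_topology {H. subgroup H G} (char_fun G)
       (product_topology (\<lambda>_. discrete_topology UNIV) (carrier G))"

lemma topspace_Sub_topology: "topspace (Sub_topology G) = {H. subgroup H G}"
  by (auto simp: Sub_topology_def topspace_pullback_topology char_fun_def)

definition Stab :: "(nat \<Rightarrow> bool) \<Rightarrow> (bool list \<Rightarrow> bool list) set" where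
  "Stab \<xi> = {g \<in> carrier Basilica. boundary_act g \<xi> = \<xi>}"

lemma subgroup_Stab: "subgroup (Stab \<xi>) Basilica"
proof (rule group.subgroupI[OF group_Basilica])
  interpret B: group Basilica by (rule group_Basilica)
  have aut: "tree_automorphism g" if "g \<in> carrier Basilica" for g
    using that group.carrier_subgroup_generated_subset[OF group_Aut_tree, of "{basilica_a, basilica_b}"]
    by (auto simp: Basilica_def Aut_tree_def)
  have mult: "g \<otimes>\<^bsub>Basilica\<^esub> h = g \<circ> h" for g h
    by (simp add: Basilica_def subgroup_generated_def Aut_tree_def)
  have one: "\<one>\<^bsub>Basilica\<^esub> = id"
    by (simp add: Basilica_def subgroup_generated_def Aut_tree_def)
  show "Stab \<xi> \<subseteq> carrier Basilica" by (auto simp: Stab_def)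
  show "Stab \<xi> \<noteq> {}"
    using B.one_closed by (auto simp: Stab_def one boundary_act_id)
  fix g assume g: "g \<in> Stab \<xi>"
  then have gc: "g \<in> carrier Basilica" and gx: "boundary_act g \<xi> = \<xi>" by (auto simp: Stab_def)
  let ?h = "inv\<^bsub>Basilica\<^esub> g"
  have hc: "?h \<in> carrier Basilica" using gc by simp
  have "?h \<circ> g = id" using B.l_inv[OF gc] by (simp add: mult one)
  then have "boundary_act ?h \<xi> = \<xi>"
    using boundary_act_comp[OF aut[OF hc] aut[OF gc], of \<xi>] by (simp add: gx boundary_act_id)
  then show "?h \<in> Stab \<xi>" using hc by (simp add: Stab_def)
  fix k assume "k \<in> Stab \<xi>"
  then have kc: "k \<in> carrier Basilica" and kx: "boundary_act k \<xi> = \<xi>" by (auto simp: Stab_def)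
  have "g \<circ> k \<in> carrier Basilica" using B.m_closed[OF gc kc] by (simp add: mult)
  then show "g \<otimes>\<^bsub>Basilica\<^esub> k \<in> Stab \<xi>"
    using boundary_act_comp[OF aut[OF gc] aut[OF kc], of \<xi>] gx kx by (simp add: Stab_def mult)
qed

definition singular_point :: "(nat \<Rightarrow> bool) \<Rightarrow> bool" where
  "singular_point \<xi> \<longleftrightarrow> \<not> topcontinuous_at boundary_topology (Sub_topology Basilica) Stab \<xi>"

definition singular_points :: "(nat \<Rightarrow> bool) set" where
  "singular_points = {\<xi>. singular_point \<xi>}"

end

theory Submission
  imports Defs
begin

text \<open>
  The assertion means that the stabiliser of a boundary point varies continuously with the point.
  In the product topology this is to be checked one group element at a time: the fixed point set
  of every \<open>g\<close> must be clopen. It is always closed, so what matters is that a fixed point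
  \<open>\<xi>\<close> of \<open>g\<close> comes with a whole cylinder of fixed points, that is, that
  the section of \<open>g\<close> at some prefix of \<open>\<xi>\<close> is trivial.

  This is shown by induction on the length of a word in \<open>a\<close>, \<open>b\<close> and their inverses that
  represents \<open>g\<close>. If \<open>g\<close> fixes \<open>\<xi>\<close>, its section at the first letter of \<open>\<xi>\<close> fixes the shifted
  point, and it suffices to treat the section instead. The section of a generator at a letter is
  a generator or trivial, so sections are represented by words that are not longer. The
  induction hypothesis applies as soon as a word gets shorter, be it because some letter has a
  trivial section or by free cancellation.

  The recursion for \<open>a\<close> and \<open>b\<close> leaves few nonempty
  freely reduced words that fix the letter \<open>x\<close> and whose section at \<open>x\<close> is equally long
  (\<open>lossless_fixing_letter\<close>): written in the order in which the letters act, these are \<open>a\<^sup>k\<close> if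
  \<open>x = 0\<close>, with section \<open>b\<^sup>k\<close>, and \<open>b\<inverse> a\<^sup>k b\<close> if \<open>x = 1\<close>, with section
  \<open>a\<inverse> b\<^sup>k a\<close>. Neither of these two sections is again on the list unless it is empty or cancels,
  so after two letters the word must have become shorter.
\<close>

section \<open>Words in the generators and their sections\<close>

datatype letter = A | Ai | B | Bi

fun letter_inv :: "letter \<Rightarrow> letter" where
  "letter_inv A = Ai" | "letter_inv Ai = A" | "letter_inv B = Bi" | "letter_inv Bi = B"

fun letter_act :: "letter \<Rightarrow> bool list \<Rightarrow> bool list" where
  "letter_act A = basilica_a"
| "letter_act Ai = inv_into UNIV basilica_a"
| "letter_act B = basilica_b"
| "letter_act Bi = inv_into UNIV basilica_b"

text \<open>The first letter of the word acts first, so that a word is read like the input of a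
  transducer.\<close>

fun word_act :: "letter list \<Rightarrow> bool list \<Rightarrow> bool list" where
  "word_act [] = id"
| "word_act (s # w) = word_act w \<circ> letter_act s"

fun letter_out :: "letter \<Rightarrow> bool \<Rightarrow> bool" where
  "letter_out A x = x"
| "letter_out Ai x = x"
| "letter_out B x = (\<not> x)"
| "letter_out Bi x = (\<not> x)"

fun letter_section :: "letter \<Rightarrow> bool \<Rightarrow> letter list" where
  "letter_section A x = (if x then [] else [B])"
| "letter_section Ai x = (if x then [] else [Bi])"
| "letter_section B x = (if x then [] else [A])"
| "letter_section Bi x = (if x then [Ai] else [])"

fun word_out :: "letter list \<Rightarrow> bool \<Rightarrow> bool" where
  "word_out [] x = x"
| "word_out (s # w) x = word_out w (letter_out s x)"

fun word_section :: "letter list \<Rightarrow> bool \<Rightarrow> letter list" where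
  "word_section [] x = []"
| "word_section (s # w) x = letter_section s x @ word_section w (letter_out s x)"

lemma tree_automorphism_basilica: "tree_automorphism basilica_a" "tree_automorphism basilica_b"
  using basilica_generators_in_Aut_tree by (simp_all add: Aut_tree_def)

lemma bij_basilica: "bij basilica_a" "bij basilica_b"
  using tree_automorphism_basilica by (simp_all add: tree_automorphism_def)

lemma inv_basilica_cancel:
  "inv_into UNIV basilica_a (basilica_a u) = u" "inv_into UNIV basilica_b (basilica_b u) = u"
  "basilica_a (inv_into UNIV basilica_a u) = u" "basilica_b (inv_into UNIV basilica_b u) = u"
  using bij_basilica by (simp_all only: bij_is_inj inv_f_f bij_is_surj surj_f_inv_f)

lemma inv_basilica_Cons:
  "inv_into UNIV basilica_a (False # u) = False # inv_into UNIV basilica_b u"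
  "inv_into UNIV basilica_a (True # u) = True # u"
  "inv_into UNIV basilica_b (True # u) = False # inv_into UNIV basilica_a u"
  "inv_into UNIV basilica_b (False # u) = True # u"
  by (rule inv_f_eq; simp add: inv_basilica_cancel bij_is_inj[OF bij_basilica(1)]
      bij_is_inj[OF bij_basilica(2)])+

lemma letter_act_Cons: "letter_act s (x # u) = letter_out s x # word_act (letter_section s x) u"
  by (cases s; cases x) (auto simp: inv_basilica_Cons)

lemma word_act_append: "word_act (v @ w) = word_act w \<circ> word_act v"
  by (induction v) (auto simp: comp_assoc)

lemma word_act_Cons: "word_act w (x # u) = word_out w x # word_act (word_section w x) u"
  by (induction w arbitrary: x u) (auto simp: letter_act_Cons word_act_append)

lemma letter_act_inv: "letter_act (letter_inv s) (letter_act s u) = u"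
  by (cases s) (auto simp: inv_basilica_cancel)

section \<open>Words that do not get shorter\<close>

lemma length_letter_section_le: "length (letter_section s x) \<le> 1"
  by (cases s) auto

lemma length_word_section_le: "length (word_section w x) \<le> length w"
proof (induction w arbitrary: x)
  case (Cons s w)
  show ?case
    using add_mono[OF length_letter_section_le[of s x] Cons.IH[of "letter_out s x"]] by simp
qed simp

lemma length_word_section_Cons:
  assumes "length (word_section (s # w) x) = length (s # w)"
  shows "length (letter_section s x) = 1"
    and "length (word_section w (letter_out s x)) = length w"
  using assms length_letter_section_le[of s x] length_word_section_le[of w "letter_out s x"]
  by simp_all

abbreviation freely_reduced :: "letter list \<Rightarrow> bool" where
  "freely_reduced \<equiv> successively (\<lambda>s t. t \<noteq> letter_inv s)"

lemma not_freely_reduced_shorter: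
  assumes "\<not> freely_reduced w"
  shows "\<exists>v. length v < length w \<and> word_act v = word_act w"
  using assms
proof (induction w)
  case (Cons s w)
  show ?case
  proof (cases "freely_reduced w")
    case True
    then obtain t v where w: "w = t # v" and "t = letter_inv s"
      using Cons.prems by (auto simp: successively_Cons neq_Nil_conv)
    then have "word_act v = word_act (s # w)" by (simp add: w fun_eq_iff letter_act_inv)
    moreover have "length v < length (s # w)" by (simp add: w)
    ultimately show ?thesis by blast
  next
    case False
    then obtain v where "length v < length w" "word_act v = word_act w"
      using Cons.IH by blast
    then have "length (s # v) < length (s # w) \<and> word_act (s # v) = word_act (s # w)" by simp
    then show ?thesis by blast
  qed
qed simp

text \<open>Starting from \<open>0\<close>, the letters \<open>a\<close> and \<open>a\<inverse>\<close> keep the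
  transducer at \<open>0\<close>, \<open>b\<inverse>\<close> would lose length, and \<open>b\<close> moves to \<open>1\<close>,
  where \<open>b\<inverse>\<close> is the only letter that keeps the length. As it would cancel, \<open>b\<close> can only come
  last.\<close>

lemma lossless_at_0:
  assumes "freely_reduced w" and "length (word_section w False) = length w"
  shows "\<exists>v v'. set v \<subseteq> {A, Ai} \<and> set v' \<subseteq> {B, Bi} \<and>
    (if word_out w False then (v @ [B], v' @ [A]) else (v, v')) = (w, word_section w False)"
  using assms
proof (induction w)
  case (Cons s w)
  have red: "freely_reduced w" using Cons.prems(1) by (auto simp: successively_Cons)
  note loss = length_word_section_Cons[OF Cons.prems(2)]
  show ?case
  proof (cases "s = A \<or> s = Ai")
    case True
    then have out: "letter_out s False = False" by auto
    obtain v v' where v: "set v \<subseteq> {A, Ai}" "set v' \<subseteq> {B, Bi}"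
      "(if word_out w False then (v @ [B], v' @ [A]) else (v, v')) = (w, word_section w False)"
      using Cons.IH[OF red] loss(2) unfolding out by blast
    have "set (s # v) \<subseteq> {A, Ai}" "set (letter_section s False @ v') \<subseteq> {B, Bi}"
      using True v(1,2) by auto
    moreover have
      "(if word_out (s # w) False then ((s # v) @ [B], (letter_section s False @ v') @ [A])
        else (s # v, letter_section s False @ v')) = (s # w, word_section (s # w) False)"
      using v(3) by (cases "word_out w False") (simp_all add: out)
    ultimately show ?thesis by blast
  next
    case False
    then have s: "s = B" using loss(1) by (cases s) auto
    have "w = []"
    proof (cases w)
      case (Cons t u)
      have "length (letter_section t True) = 1"
        using length_word_section_Cons(1)[of t u True] loss(2) s Cons by simp
      then have "t = Bi" by (cases t) auto
      then show ?thesis using Cons.prems(1) s Cons by simp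
    qed simp
    then show ?thesis using s by (intro exI[of _ "[]"]) simp
  qed
qed simp

text \<open>At \<open>1\<close> only \<open>b\<inverse>\<close> keeps the length, and it leads to the
  situation at \<open>0\<close>.\<close>

lemma lossless_fixing_letter:
  assumes red: "freely_reduced w" and len: "length (word_section w x) = length w"
    and out: "word_out w x = x" and "w \<noteq> []"
  obtains
    (zero) "\<not> x" "set w \<subseteq> {A, Ai}" "set (word_section w x) \<subseteq> {B, Bi}"
  | (one) v v' where "x" "set v \<subseteq> {A, Ai}" "set v' \<subseteq> {B, Bi}"
      "w = Bi # v @ [B]" "word_section w x = Ai # v' @ [A]"
proof (cases x)
  case False
  then show thesis using lossless_at_0[OF red] len out zero by auto
next
  case True
  obtain s u where w: "w = s # u" using \<open>w \<noteq> []\<close> by (cases w) auto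
  note loss = length_word_section_Cons[of s u x]
  have s: "s = Bi" using loss(1) len True w by (cases s) auto
  have "freely_reduced u" "length (word_section u False) = length u" "word_out u False"
    using red loss(2) len out True s w by (auto simp: successively_Cons)
  then show thesis using lossless_at_0[of u] one True s w by auto
qed

text \<open>The sections \<open>b\<^sup>k\<close> and \<open>a\<inverse> b\<^sup>k a\<close> of the previous lemma have neither
  of the shapes \<open>a\<^sup>k\<close> and \<open>b\<inverse> a\<^sup>k b\<close> when they are nonempty and freely reduced.\<close>

lemma lossless_twice_imp_Nil:
  assumes "freely_reduced w" "length (word_section w x) = length w" "word_out w x = x"
    and red': "freely_reduced (word_section w x)"
    and len': "length (word_section (word_section w x) y) = length (word_section w x)"
    and out': "word_out (word_section w x) y = y"
  shows "w = []"
proof (rule ccontr)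
  assume "w \<noteq> []"
  then have ne: "word_section w x \<noteq> []" using assms(2) by auto
  from assms(1-3) \<open>w \<noteq> []\<close> show False
  proof (cases rule: lossless_fixing_letter)
    case zero
    from red' len' out' ne show False
    proof (cases rule: lossless_fixing_letter)
      case zero
      then show False using \<open>set (word_section w x) \<subseteq> {B, Bi}\<close> ne
        by (cases "word_section w x") auto
    next
      case (one v v')
      then have "v = []" using zero by (cases v) auto
      then show False using one red' by simp
    qed
  next
    case (one v v')
    from red' len' out' ne show False
    proof (cases rule: lossless_fixing_letter)
      case zero
      then have "v' = []" using one by (cases v') auto
      then show False using one red' by simp
    next
      case (one u u')
      then show False using \<open>word_section w x = Ai # v' @ [A]\<close> by simp
    qed
  qed
qed

section \<open>Fixed points are interior\<close>

lemma prefix_of_Suc: "prefix_of (Suc n) \<xi> = \<xi> 0 # prefix_of n (\<lambda>i. \<xi> (Suc i))"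
  by (simp add: prefix_of_def map_upt_Suc del: upt_Suc)

text \<open>Fixing all prefixes of \<open>\<xi>\<close> is inherited by the section at the first letter,
  and fixing a cylinder is inherited in the opposite direction. Hence \<open>w\<close> may be replaced by its
  section, or by the section of its section, and for nonempty \<open>w\<close> one of these three
  admits a representative shorter than \<open>w\<close>.\<close>

lemma word_act_fixes_cylinder:
  assumes "\<And>n. word_act w (prefix_of n \<xi>) = prefix_of n \<xi>"
  shows "\<exists>n. \<forall>u. word_act w (prefix_of n \<xi> @ u) = prefix_of n \<xi> @ u"
  using assms
proof (induction "length w" arbitrary: w \<xi> rule: less_induct)
  case less
  let ?shift = "\<lambda>\<eta> :: nat \<Rightarrow> bool. \<lambda>i. \<eta> (Suc i)"
  let ?fixes = "\<lambda>w \<eta>. \<forall>n. word_act w (prefix_of n \<eta>) = prefix_of n \<eta>"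
  let ?goal = "\<lambda>w \<eta>. \<exists>n. \<forall>u. word_act w (prefix_of n \<eta> @ u) = prefix_of n \<eta> @ u"
  have section_fixes: "word_out v (\<eta> 0) = \<eta> 0 \<and> ?fixes (word_section v (\<eta> 0)) (?shift \<eta>)"
    if "?fixes v \<eta>" for v \<eta>
  proof -
    have "word_act v (prefix_of (Suc n) \<eta>) = prefix_of (Suc n) \<eta>" for n
      using that by blast
    then show ?thesis by (simp add: prefix_of_Suc word_act_Cons)
  qed
  have goal_lift: "?goal v \<eta>"
    if fix_letter: "word_out v (\<eta> 0) = \<eta> 0"
      and sec: "?goal (word_section v (\<eta> 0)) (?shift \<eta>)" for v \<eta>
  proof -
    obtain n where "\<forall>u. word_act (word_section v (\<eta> 0)) (prefix_of n (?shift \<eta>) @ u)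
        = prefix_of n (?shift \<eta>) @ u"
      using sec by blast
    then have "\<forall>u. word_act v (prefix_of (Suc n) \<eta> @ u) = prefix_of (Suc n) \<eta> @ u"
      using fix_letter by (simp add: prefix_of_Suc word_act_Cons)
    then show ?thesis by blast
  qed
  have shorter: "?goal v \<eta>" if "length v < length w" "?fixes v \<eta>" for v \<eta>
    using less.hyps[OF that(1)] that(2) by blast
  have reduce: "?goal v \<eta>" if "\<not> freely_reduced v" "length v \<le> length w" "?fixes v \<eta>" for v \<eta>
  proof -
    obtain v' where v': "length v' < length v" "word_act v' = word_act v"
      using not_freely_reduced_shorter[OF \<open>\<not> freely_reduced v\<close>] by blast
    then show ?thesis using shorter[of v' \<eta>] that(2,3) by simp
  qed
  have fixw: "?fixes w \<xi>" using less.prems by blast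
  let ?w' = "word_section w (\<xi> 0)" and ?\<xi>' = "?shift \<xi>"
  let ?w'' = "word_section ?w' (\<xi> 1)"
  note fixw' = section_fixes[OF fixw]
  note fixw'' = section_fixes[OF conjunct2[OF fixw'], simplified]
  have le': "length ?w' \<le> length w" by (rule length_word_section_le)
  have le'': "length ?w'' \<le> length ?w'" by (rule length_word_section_le)
  have "?goal w \<xi>" if "w \<noteq> []"
  proof -
    have "\<not> freely_reduced w \<or> length ?w' < length w \<or> \<not> freely_reduced ?w' \<or>
        length ?w'' < length ?w'"
      using lossless_twice_imp_Nil[of w "\<xi> 0" "\<xi> 1"] fixw' fixw'' le' le'' that by force
    then consider "\<not> freely_reduced w" | "length ?w' < length w" | "\<not> freely_reduced ?w'"
      | "length ?w'' < length w"
      using le' by linarith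
    then show ?thesis
    proof cases
      case 1
      then show ?thesis using reduce fixw by blast
    next
      case 2
      then show ?thesis using shorter fixw' goal_lift by blast
    next
      case 3
      then show ?thesis using reduce le' fixw' goal_lift by blast
    next
      case 4
      then have "?goal ?w'' (?shift ?\<xi>')" using shorter fixw'' by simp
      then have "?goal ?w' ?\<xi>'" using goal_lift[of ?w' ?\<xi>'] fixw'' by simp
      then show ?thesis using goal_lift fixw' by blast
    qed
  qed
  moreover have "?goal w \<xi>" if "w = []" using that by simp
  ultimately show ?case by blast
qed

lemma inv_Aut_tree:
  assumes "tree_automorphism g"
  shows "inv\<^bsub>Aut_tree\<^esub> g = inv_into UNIV g"
proof -
  have g: "g \<in> carrier Aut_tree" using assms by (simp add: Aut_tree_def)
  let ?h = "inv\<^bsub>Aut_tree\<^esub> g"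
  have "g \<circ> ?h = id" "?h \<circ> g = id"
    using group.r_inv[OF group_Aut_tree g] group.l_inv[OF group_Aut_tree g]
    by (simp_all add: Aut_tree_def)
  then show ?thesis by (rule inv_unique_comp[symmetric])
qed

lemma Basilica_eq_word_act:
  assumes "g \<in> carrier Basilica"
  shows "\<exists>w. g = word_act w"
  using assms unfolding carrier_Basilica
proof (induction rule: generate.induct)
  case one
  have "\<one>\<^bsub>Aut_tree\<^esub> = word_act []" by (simp add: Aut_tree_def)
  then show ?case by blast
next
  case (incl h)
  then have "h = word_act [A] \<or> h = word_act [B]" by auto
  then show ?case by blast
next
  case (inv h)
  then have "inv\<^bsub>Aut_tree\<^esub> h = word_act [Ai] \<or> inv\<^bsub>Aut_tree\<^esub> h = word_act [Bi]"
    using inv_Aut_tree tree_automorphism_basilica by auto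
  then show ?case by blast
next
  case (eng g h)
  then obtain v w where "g = word_act v" "h = word_act w" by blast
  then have "g \<otimes>\<^bsub>Aut_tree\<^esub> h = word_act (w @ v)" by (simp add: Aut_tree_def word_act_append)
  then show ?case by blast
qed

lemma tree_automorphism_Basilica: "g \<in> carrier Basilica \<Longrightarrow> tree_automorphism g"
  using group.carrier_subgroup_generated_subset[OF group_Aut_tree, of "{basilica_a, basilica_b}"]
  by (auto simp: Basilica_def Aut_tree_def)

lemma boundary_act_eq_self_iff:
  assumes "tree_automorphism g"
  shows "boundary_act g \<xi> = \<xi> \<longleftrightarrow> (\<forall>n. g (prefix_of n \<xi>) = prefix_of n \<xi>)"
proof
  show "\<forall>n. g (prefix_of n \<xi>) = prefix_of n \<xi>" if "boundary_act g \<xi> = \<xi>"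
    using prefix_of_boundary_act[OF assms, of _ \<xi>] that by simp
  show "boundary_act g \<xi> = \<xi>" if "\<forall>n. g (prefix_of n \<xi>) = prefix_of n \<xi>"
    using that by (intro prefix_of_eqI) (simp add: prefix_of_boundary_act[OF assms])
qed

lemma prefix_of_add: "\<exists>u. prefix_of (n + k) \<eta> = prefix_of n \<eta> @ u"
  by (simp add: prefix_of_def upt_add_eq_append[of 0 n k])

lemma fixed_point_interior:
  assumes g: "g \<in> carrier Basilica" and fixed: "boundary_act g \<xi> = \<xi>"
  shows "\<exists>n. \<forall>\<eta>. prefix_of n \<eta> = prefix_of n \<xi> \<longrightarrow> boundary_act g \<eta> = \<eta>"
proof -
  note aut = tree_automorphism_Basilica[OF g]
  obtain w where w: "g = word_act w" using Basilica_eq_word_act[OF g] by blast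
  obtain n where n: "\<And>u. g (prefix_of n \<xi> @ u) = prefix_of n \<xi> @ u"
    using word_act_fixes_cylinder[of w \<xi>] fixed boundary_act_eq_self_iff[OF aut] w by blast
  have "boundary_act g \<eta> = \<eta>" if pre: "prefix_of n \<eta> = prefix_of n \<xi>" for \<eta>
  proof -
    have long: "g (prefix_of (n + k) \<eta>) = prefix_of (n + k) \<eta>" for k
      using prefix_of_add[of n k \<eta>] n pre by auto
    have "prefix_of m (boundary_act g \<eta>) = prefix_of m \<eta>" for m
    proof -
      have "take m (g (prefix_of (n + m) \<eta>)) = take m (prefix_of (n + m) \<eta>)" by (simp add: long)
      moreover have "take m (prefix_of (n + m) \<eta>) = prefix_of m \<eta>"
        by (simp add: prefix_of_def take_map)
      ultimately show ?thesis
        by (simp add: tree_automorphism_take[OF aut] prefix_of_boundary_act[OF aut])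
    qed
    then show ?thesis by (rule prefix_of_eqI)
  qed
  then show ?thesis by blast
qed

section \<open>Continuity of the stabiliser map\<close>

lemma topspace_boundary_topology: "topspace boundary_topology = UNIV"
  by (simp add: boundary_topology_def)

lemma openin_cylinder: "openin boundary_topology {\<eta>. prefix_of n \<eta> = prefix_of n \<xi>}"
proof (induction n)
  case 0
  then show ?case
    using openin_topspace[of boundary_topology]
    by (simp add: prefix_of_def topspace_boundary_topology)
next
  case (Suc n)
  have "continuous_map boundary_topology (discrete_topology UNIV) (\<lambda>\<eta>. \<eta> n)"
    unfolding boundary_topology_def by (rule continuous_map_product_projection) simp
  then have "openin boundary_topology {\<eta> \<in> topspace boundary_topology. \<eta> n \<in> {\<xi> n}}"
    by (rule openin_continuous_map_preimage) simp
  then have "openin boundary_topology {\<eta>. \<eta> n = \<xi> n}"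
    by (simp add: topspace_boundary_topology)
  moreover have "{\<eta>. prefix_of (Suc n) \<eta> = prefix_of (Suc n) \<xi>}
      = {\<eta>. prefix_of n \<eta> = prefix_of n \<xi>} \<inter> {\<eta>. \<eta> n = \<xi> n}"
    by (auto simp: prefix_of_def)
  ultimately show ?case using Suc by auto
qed

lemma openin_boundary_topologyI:
  assumes "\<And>\<xi>. \<xi> \<in> S \<Longrightarrow> \<exists>n. \<forall>\<eta>. prefix_of n \<eta> = prefix_of n \<xi> \<longrightarrow> \<eta> \<in> S"
  shows "openin boundary_topology S"
proof (subst openin_subopen, intro ballI)
  fix \<xi> assume "\<xi> \<in> S"
  then obtain n where "\<forall>\<eta>. prefix_of n \<eta> = prefix_of n \<xi> \<longrightarrow> \<eta> \<in> S" using assms by blast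
  then show "\<exists>T. openin boundary_topology T \<and> \<xi> \<in> T \<and> T \<subseteq> S"
    using openin_cylinder[of n \<xi>] by blast
qed

text \<open>Openness of the complement holds for every tree automorphism, since moving a point is
  witnessed by a finite prefix; openness of the fixed point set is where the Basilica group
  enters.\<close>

lemma fixed_points_clopen:
  assumes g: "g \<in> carrier Basilica"
  shows "openin boundary_topology {\<xi>. boundary_act g \<xi> = \<xi>}"
    and "openin boundary_topology {\<xi>. boundary_act g \<xi> \<noteq> \<xi>}"
proof -
  show "openin boundary_topology {\<xi>. boundary_act g \<xi> = \<xi>}"
    using fixed_point_interior[OF g] by (auto intro!: openin_boundary_topologyI)
  show "openin boundary_topology {\<xi>. boundary_act g \<xi> \<noteq> \<xi>}"
  proof (rule openin_boundary_topologyI)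
    fix \<xi> assume "\<xi> \<in> {\<xi>. boundary_act g \<xi> \<noteq> \<xi>}"
    then obtain n where "g (prefix_of n \<xi>) \<noteq> prefix_of n \<xi>"
      using boundary_act_eq_self_iff[OF tree_automorphism_Basilica[OF g]] by auto
    then have "\<forall>\<eta>. prefix_of n \<eta> = prefix_of n \<xi> \<longrightarrow> boundary_act g \<eta> \<noteq> \<eta>"
      using boundary_act_eq_self_iff[OF tree_automorphism_Basilica[OF g]] by metis
    then show "\<exists>n. \<forall>\<eta>. prefix_of n \<eta> = prefix_of n \<xi> \<longrightarrow> \<eta> \<in> {\<xi>. boundary_act g \<xi> \<noteq> \<xi>}"
      by blast
  qed
qed

text \<open>A coordinate of the characteristic function of the stabiliser belongs to one group element
  \<open>g\<close>, and its level sets are the fixed point set of \<open>g\<close> and the complement.\<close>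

lemma continuous_map_Stab: "continuous_map boundary_topology (Sub_topology Basilica) Stab"
  unfolding Sub_topology_def
proof (rule continuous_map_pullback')
  show "topspace boundary_topology \<subseteq> Stab -` {H. subgroup H Basilica}"
    using subgroup_Stab by auto
  have "continuous_map boundary_topology (discrete_topology UNIV)
      (\<lambda>\<xi>. char_fun Basilica (Stab \<xi>) g)" if g: "g \<in> carrier Basilica" for g
    unfolding continuous_map_def
  proof (intro conjI allI impI)
    fix U :: "bool set"
    have "{\<xi> \<in> topspace boundary_topology. char_fun Basilica (Stab \<xi>) g \<in> U}
        = (if True \<in> U then {\<xi>. boundary_act g \<xi> = \<xi>} else {}) \<union>
          (if False \<in> U then {\<xi>. boundary_act g \<xi> \<noteq> \<xi>} else {})"
      (is "?L = ?R")
    proof (rule Set.set_eqI)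
      show "\<xi> \<in> ?L \<longleftrightarrow> \<xi> \<in> ?R" for \<xi>
        using g by (cases "boundary_act g \<xi> = \<xi>")
          (simp_all add: char_fun_def Stab_def topspace_boundary_topology)
    qed
    then show "openin boundary_topology
        {\<xi> \<in> topspace boundary_topology. char_fun Basilica (Stab \<xi>) g \<in> U}"
      using fixed_points_clopen[OF g] by (auto intro!: openin_Un)
  qed simp
  then show "continuous_map boundary_topology
      (product_topology (\<lambda>_. discrete_topology UNIV) (carrier Basilica))
      (char_fun Basilica \<circ> Stab)"
    by (auto simp: continuous_map_componentwise char_fun_def)
qed

theorem corollary4p8:
  shows "singular_points = {}"
  using continuous_map_Stab
  by (simp add: singular_points_def singular_point_def continuous_map_eq_topcontinuous_at
      topspace_boundary_topology)

end
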